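(* Let $M$ be a finite group, $\pi$ a finite-dimensional unitary representation of $M$, $c>0$, and let $d$ be the minimal number of edges of a homotopically non-trivial loop of $\mathcal G$. For $\varepsilon\in(0,1)$, replace the killing measure $\kappa$ by $\kappa^{\varepsilon}=\kappa+\frac{\lambda(1-\varepsilon)}{\varepsilon}$ (so that $\lambda$ is replaced by $\lambda/\varepsilon$), let $\mu^{\varepsilon}$ be the corresponding loop measure, take $\alpha=c\,\varepsilon^{-d}$, and let $$\Lambda_{\pi}^{\alpha}(U)=\exp\Bigl(\alpha\sum_{l}\mu^{\varepsilon}(l)\bigl(\chi_\pi(C_U(l))-1\bigr)\Bigr),$$ the sum being over all non-trivial discrete loops $l$. Then, for every $M$-assignment $U$, as $\varepsilon\to0$, the weights $\Lambda_\pi^{\alpha}(U)$ converge to $$\Lambda_{\pi,c}(U)=\exp\Bigl(c\sum_{l\in\mathcal P}\mu(l)\bigl(\chi_\pi(C_U(l))-1\bigr)\Bigr),$$ where $\mathcal P$ is the set of plaquettes and $\mu$ is the loop measure associated with the original data $(C,\kappa)$.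
   Context: Let $\mathcal G=(X,E)$ be a finite connected graph without loop-edges or multiple edges, not a tree. Let $C_{x,y}=C_{y,x}\ge 0$ be conductances indexed by the edges (with $C_{x,y}=0$ if $\{x,y\}\notin E$) and let $\kappa_x\ge0$, $x\in X$, be a killing measure. Put $\lambda_x=\sum_yC_{x,y}+\kappa_x$ and assume that the energy $\mathcal E(f,f)=\frac12\sum_{x,y}C_{x,y}(f(x)-f(y))^2+\sum_x\kappa_xf(x)^2$ is positive definite. Let $P_{x,y}=C_{x,y}/\lambda_x$ be the transition matrix. A discrete based loop of length $n\ge2$ is a sequence $(\xi_1,\dots,\xi_n)$ in $X$ with $\{\xi_i,\xi_{i+1}\}\in E$ for all $1\le i\le n$, where $\xi_{n+1}=\xi_1$; it has $n$ edges (counted with repetition). A non-trivial discrete loop $l$ is an equivalence class of such sequences under cyclic shift. The loop measure associated with $(C,\kappa)$ gives it mass $\mu(l)=\frac1m\prod_{i=1}^nP_{\xi_i,\xi_{i+1}}$, where $m$ is the multiplicity of $l$ (the largest integer $m$ such that the sequence is the $m$-fold repetition of a shorter based loop; $m=1$ if aperiodic). The measure $\mu^\varepsilon$ is defined in the same way from $(C,\kappa^\varepsilon)$. A loop is homotopically trivial if removing recursively all its tail edges (pairs of consecutive, in the cyclic order, mutually inverse oriented edges) reduces it to a point, and homotopically non-trivial otherwise. Plaquettes are the homotopically non-trivial loops of minimal length, i.e. those with exactly $d$ edges; $\mathcal P$ is the set of plaquettes. An $M$-assignment $U$ is a choice, for each oriented edge $(x,y)$, of an element $U_{(x,y)}\in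 M$ such that $U_{(y,x)}=U_{(x,y)}^{-1}$. For a loop $l$ represented by $(\xi_1,\dots,\xi_n)$, $C_U(l)$ is the conjugacy class in $M$ of the ordered product $U_{(\xi_1,\xi_2)}U_{(\xi_2,\xi_3)}\cdots U_{(\xi_n,\xi_1)}$ (independent of the choice of base point). $\chi_\pi$ is the normalized character $\chi_\pi(g)=\frac{1}{\dim(\pi)}\mathrm{Tr}(\pi(g))$, a class function on $M$ with $\chi_\pi(1)=1$, hence a function on conjugacy classes. *)

theory Defs
  imports "HOL-Analysis.Analysis" "HOL-Algebra.Group"
begin

definition simple_graph :: "'v set \<Rightarrow> 'v set set \<Rightarrow> bool" where
  "simple_graph X E \<longleftrightarrow> finite X \<and> (\<forall>e\<in>E. e \<subseteq> X \<and> card e = 2)"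

definition connected_graph :: "'v set \<Rightarrow> 'v set set \<Rightarrow> bool" where
  "connected_graph X E \<longleftrightarrow>
     X \<noteq> {} \<and> (\<forall>x\<in>X. \<forall>y\<in>X. (x, y) \<in> {(u, v). {u, v} \<in> E}\<^sup>*)"

text \<open>
  The oriented edges of the closed path through \<open>\<xi>\<^sub>1, \<dots>, \<xi>\<^sub>n\<close> (with \<open>\<xi>\<^sub>n\<^sub>+\<^sub>1 = \<xi>\<^sub>1\<close>), in order.
\<close>

definition loop_edges :: "'v list \<Rightarrow> ('v \<times> 'v) list" where
  "loop_edges xs = zip xs (rotate1 xs)"

text \<open>
  Cycles have length at least 3: an edge traversed back and forth is not a cycle. (With the digraph
  convention, where it is one, every graph with an edge would fail to be a tree.)
\<close>

definition is_cycle :: "'v set set \<Rightarrow> 'v list \<Rightarrow> bool" where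
  "is_cycle E xs \<longleftrightarrow>
     length xs \<ge> 3 \<and> distinct xs \<and> (\<forall>(x, y)\<in>set (loop_edges xs). {x, y} \<in> E)"

definition is_tree :: "'v set \<Rightarrow> 'v set set \<Rightarrow> bool" where
  "is_tree X E \<longleftrightarrow> connected_graph X E \<and> (\<nexists>xs. is_cycle E xs)"

definition based_loops :: "'v set \<Rightarrow> 'v set set \<Rightarrow> 'v list set" where
  "based_loops X E =
     {xs. length xs \<ge> 2 \<and> set xs \<subseteq> X \<and> (\<forall>(x, y)\<in>set (loop_edges xs). {x, y} \<in> E)}"

definition shift_rel :: "'v set \<Rightarrow> 'v set set \<Rightarrow> ('v list \<times> 'v list) set" where
  "shift_rel X E = {(xs, ys). xs \<in> based_loops X E \<and> (\<exists>k. ys = rotate k xs)}"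

definition loops :: "'v set \<Rightarrow> 'v set set \<Rightarrow> 'v list set set" where
  "loops X E = based_loops X E // shift_rel X E"

text \<open>
  A quantity \<open>f\<close> on based loops that is invariant under cyclic shift takes a single value on each
  loop \<open>l\<close>, namely \<open>the_elem (f ` l)\<close>; loop functionals are defined from based ones in this way.
\<close>

definition loop_length :: "'v list set \<Rightarrow> nat" where
  "loop_length l = the_elem (length ` l)"

text \<open>
  A list \<open>ys\<close> with \<open>xs = concat (replicate m ys)\<close> is automatically a based loop when \<open>xs\<close> is one.
\<close>

definition loop_multiplicity :: "'v list set \<Rightarrow> nat" where
  "loop_multiplicity l =
     the_elem ((\<lambda>xs. Max {m. \<exists>ys. xs = concat (replicate m ys)}) ` l)"

text \<open>
  One removal of a tail edge from a cyclic sequence of oriented edges. The rotation brings the two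
  mutually inverse consecutive edges to the front, so that the last and the first edge also count
  as consecutive. The empty sequence of edges stands for a point.
\<close>

definition tail_removal :: "('v \<times> 'v) list \<Rightarrow> ('v \<times> 'v) list \<Rightarrow> bool" where
  "tail_removal es fs \<longleftrightarrow> (\<exists>k x y. rotate k es = (x, y) # (y, x) # fs)"

definition homotopically_trivial :: "'v list set \<Rightarrow> bool" where
  "homotopically_trivial l \<longleftrightarrow> (\<exists>xs\<in>l. tail_removal\<^sup>*\<^sup>* (loop_edges xs) [])"

definition min_nontrivial_length :: "'v set \<Rightarrow> 'v set set \<Rightarrow> nat" where
  "min_nontrivial_length X E =
     (LEAST n. \<exists>l\<in>loops X E. \<not> homotopically_trivial l \<and> loop_length l = n)"

definition plaquettes :: "'v set \<Rightarrow> 'v set set \<Rightarrow> 'v list set set" where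
  "plaquettes X E =
     {l \<in> loops X E. \<not> homotopically_trivial l \<and> loop_length l = min_nontrivial_length X E}"

definition conductances :: "'v set \<Rightarrow> 'v set set \<Rightarrow> ('v \<Rightarrow> 'v \<Rightarrow> real) \<Rightarrow> bool" where
  "conductances X E C \<longleftrightarrow>
     (\<forall>x\<in>X. \<forall>y\<in>X. C x y = C y x \<and> C x y \<ge> 0 \<and> ({x, y} \<notin> E \<longrightarrow> C x y = 0))"

definition energy :: "'v set \<Rightarrow> ('v \<Rightarrow> 'v \<Rightarrow> real) \<Rightarrow> ('v \<Rightarrow> real) \<Rightarrow> ('v \<Rightarrow> real) \<Rightarrow> real" where
  "energy X C \<kappa> f =
     1/2 * (\<Sum>x\<in>X. \<Sum>y\<in>X. C x y * (f x - f y)^2) + (\<Sum>x\<in>X. \<kappa> x * (f x)^2)"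

definition energy_pos_def :: "'v set \<Rightarrow> ('v \<Rightarrow> 'v \<Rightarrow> real) \<Rightarrow> ('v \<Rightarrow> real) \<Rightarrow> bool" where
  "energy_pos_def X C \<kappa> \<longleftrightarrow> (\<forall>f. (\<exists>x\<in>X. f x \<noteq> 0) \<longrightarrow> energy X C \<kappa> f > 0)"

definition total_weight :: "'v set \<Rightarrow> ('v \<Rightarrow> 'v \<Rightarrow> real) \<Rightarrow> ('v \<Rightarrow> real) \<Rightarrow> 'v \<Rightarrow> real" where
  "total_weight X C \<kappa> x = (\<Sum>y\<in>X. C x y) + \<kappa> x"

definition transition :: "'v set \<Rightarrow> ('v \<Rightarrow> 'v \<Rightarrow> real) \<Rightarrow> ('v \<Rightarrow> real) \<Rightarrow> 'v \<Rightarrow> 'v \<Rightarrow> real" where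
  "transition X C \<kappa> x y = C x y / total_weight X C \<kappa> x"

definition loop_measure ::
    "'v set \<Rightarrow> ('v \<Rightarrow> 'v \<Rightarrow> real) \<Rightarrow> ('v \<Rightarrow> real) \<Rightarrow> 'v list set \<Rightarrow> real" where
  "loop_measure X C \<kappa> l =
     1 / real (loop_multiplicity l) *
     the_elem ((\<lambda>xs. \<Prod>(x, y)\<leftarrow>loop_edges xs. transition X C \<kappa> x y) ` l)"

definition scaled_killing ::
    "'v set \<Rightarrow> ('v \<Rightarrow> 'v \<Rightarrow> real) \<Rightarrow> ('v \<Rightarrow> real) \<Rightarrow> real \<Rightarrow> 'v \<Rightarrow> real" where
  "scaled_killing X C \<kappa> \<epsilon> x = \<kappa> x + total_weight X C \<kappa> x * (1 - \<epsilon>) / \<epsilon>"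

definition conjugacy_class :: "('m, 'b) monoid_scheme \<Rightarrow> 'm \<Rightarrow> 'm set" where
  "conjugacy_class M g = {h \<otimes>\<^bsub>M\<^esub> g \<otimes>\<^bsub>M\<^esub> inv\<^bsub>M\<^esub> h | h. h \<in> carrier M}"

definition assignment :: "'v set set \<Rightarrow> ('m, 'b) monoid_scheme \<Rightarrow> ('v \<times> 'v \<Rightarrow> 'm) \<Rightarrow> bool" where
  "assignment E M U \<longleftrightarrow>
     (\<forall>x y. {x, y} \<in> E \<longrightarrow> U (x, y) \<in> carrier M \<and> U (y, x) = inv\<^bsub>M\<^esub> U (x, y))"

definition holonomy_class ::
    "('m, 'b) monoid_scheme \<Rightarrow> ('v \<times> 'v \<Rightarrow> 'm) \<Rightarrow> 'v list set \<Rightarrow> 'm set" where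
  "holonomy_class M U l =
     the_elem ((\<lambda>xs. conjugacy_class M (foldr (\<otimes>\<^bsub>M\<^esub>) (map U (loop_edges xs)) \<one>\<^bsub>M\<^esub>)) ` l)"

definition adjoint_matrix :: "complex^'n^'n \<Rightarrow> complex^'n^'n" where
  "adjoint_matrix A = (\<chi> i j. cnj (A $ j $ i))"

definition unitary_group :: "(complex^'n^'n) monoid" where
  "unitary_group =
     \<lparr>carrier = {A. A ** adjoint_matrix A = mat 1 \<and> adjoint_matrix A ** A = mat 1},
      monoid.mult = (**), one = mat 1\<rparr>"

definition unitary_representation ::
    "('m, 'b) monoid_scheme \<Rightarrow> ('m \<Rightarrow> complex^'n^'n) \<Rightarrow> bool" where
  "unitary_representation M \<pi> \<longleftrightarrow> \<pi> \<in> hom M unitary_group"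

definition normalized_character :: "('m \<Rightarrow> complex^'n^'n) \<Rightarrow> 'm \<Rightarrow> complex" where
  "normalized_character \<pi> g = trace (\<pi> g) / of_nat CARD('n)"

text \<open>
  The common value of the class function \<open>normalized_character \<pi>\<close> on a conjugacy class \<open>K\<close>.
\<close>

definition class_character :: "('m \<Rightarrow> complex^'n^'n) \<Rightarrow> 'm set \<Rightarrow> complex" where
  "class_character \<pi> K = the_elem (normalized_character \<pi> ` K)"

definition loop_term ::
    "'v set \<Rightarrow> ('v \<Rightarrow> 'v \<Rightarrow> real) \<Rightarrow> ('v \<Rightarrow> real) \<Rightarrow> ('m, 'b) monoid_scheme \<Rightarrow>
     ('m \<Rightarrow> complex^'n^'n) \<Rightarrow> ('v \<times> 'v \<Rightarrow> 'm) \<Rightarrow> 'v list set \<Rightarrow> complex" where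
  "loop_term X C \<kappa> M \<pi> U l =
     of_real (loop_measure X C \<kappa> l) * (class_character \<pi> (holonomy_class M U l) - 1)"

definition loop_weight ::
    "'v set \<Rightarrow> 'v set set \<Rightarrow> ('v \<Rightarrow> 'v \<Rightarrow> real) \<Rightarrow> ('v \<Rightarrow> real) \<Rightarrow> ('m, 'b) monoid_scheme \<Rightarrow>
     ('m \<Rightarrow> complex^'n^'n) \<Rightarrow> real \<Rightarrow> ('v \<times> 'v \<Rightarrow> 'm) \<Rightarrow> complex" where
  "loop_weight X E C \<kappa> M \<pi> \<alpha> U =
     exp (of_real \<alpha> * (\<Sum>\<^sub>\<infinity>l\<in>loops X E. loop_term X C \<kappa> M \<pi> U l))"

definition plaquette_weight ::
    "'v set \<Rightarrow> 'v set set \<Rightarrow> ('v \<Rightarrow> 'v \<Rightarrow> real) \<Rightarrow> ('v \<Rightarrow> real) \<Rightarrow> ('m, 'b) monoid_scheme \<Rightarrow>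
     ('m \<Rightarrow> complex^'n^'n) \<Rightarrow> real \<Rightarrow> ('v \<times> 'v \<Rightarrow> 'm) \<Rightarrow> complex" where
  "plaquette_weight X E C \<kappa> M \<pi> c U =
     exp (of_real c * (\<Sum>l\<in>plaquettes X E. loop_term X C \<kappa> M \<pi> U l))"

end

theory Submission
  imports Defs
begin

text \<open>
  Passing from \<open>\<kappa>\<close> to \<open>\<kappa>\<^sup>\<epsilon>\<close> multiplies every transition probability by \<open>\<epsilon>\<close>, so a loop with \<open>n\<close>
  edges gets mass \<open>\<epsilon>\<^sup>n \<mu>(l)\<close>. Removing a tail edge changes the holonomy at most by conjugation, so
  homotopically trivial loops have trivial holonomy and contribute nothing. The sum over loops
  therefore starts at order \<open>\<epsilon>\<^sup>d\<close>, and its coefficient there is the sum over plaquettes. The rows of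
  \<open>P\<close> sum to at most 1, so the based loops of length \<open>n\<close> have total mass at most \<open>|X|\<close>, and the
  higher orders are dominated by a geometric series.
\<close>

section \<open>Leading order of a power-weighted sum\<close>

text \<open>Outside \<open>P\<close> only exponents of at least \<open>d + 1\<close> survive.
  Measured against its value at 1/2, such a term gains a factor
  \<open>(2 * \<epsilon>) ^ Suc d\<close>, so the remainder divided by \<open>\<epsilon> ^ d\<close>
  is bounded by a multiple of \<epsilon>.\<close>

lemma infsum_power_leading_order:
  fixes t :: "'a \<Rightarrow> complex" and n :: "'a \<Rightarrow> nat"
  assumes summ: "\<And>\<epsilon>::real. 0 < \<epsilon> \<Longrightarrow> \<epsilon> < 1 \<Longrightarrow> (\<lambda>l. \<epsilon> ^ n l * norm (t l)) summable_on L"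
    and "finite P" "P \<subseteq> L" and deg: "\<And>l. l \<in> P \<Longrightarrow> n l = d"
    and vanish: "\<And>l. l \<in> L - P \<Longrightarrow> n l \<le> d \<Longrightarrow> t l = 0"
  shows "((\<lambda>\<epsilon>::real. (\<Sum>\<^sub>\<infinity>l\<in>L. of_real (\<epsilon> ^ n l) * t l) / of_real (\<epsilon> ^ d)) \<longlongrightarrow> (\<Sum>l\<in>P. t l)) (at_right 0)"
proof -
  \<comment> \<open>The fixed reference point is 1/2, where the sum converges; the prefactor is what
    remains of \<open>(2 * \<epsilon>) ^ Suc d\<close> after the power of \<epsilon> is taken
    out.\<close>
  define K where "K = 2 ^ Suc d * (\<Sum>\<^sub>\<infinity>l\<in>L-P. (1/2) ^ n l * norm (t l))"
  have summP: "(\<lambda>l. \<epsilon> ^ n l * norm (t l)) summable_on (L-P)" if "0 < \<epsilon>" "\<epsilon> < 1" for \<epsilon> :: real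
    using summ[OF that] by (rule summable_on_subset_banach) auto
  have bound: "norm ((\<Sum>\<^sub>\<infinity>l\<in>L. of_real (\<epsilon> ^ n l) * t l) / of_real (\<epsilon> ^ d) - (\<Sum>l\<in>P. t l)) \<le> \<epsilon> * K"
    if "0 < \<epsilon>" "\<epsilon> < 1/2" for \<epsilon> :: real
  proof -
    have e: "0 < \<epsilon>" "\<epsilon> < 1" using that by auto
    define f where "f = (\<lambda>l. complex_of_real (\<epsilon> ^ n l) * t l)"
    have nf: "norm (f l) = \<epsilon> ^ n l * norm (t l)" for l
      using that by (simp add: f_def norm_mult norm_power)
    have abs: "(\<lambda>l. norm (f l)) summable_on (L-P)"
      unfolding nf by (rule summP) (use e in auto)
    have fP: "infsum f P = of_real (\<epsilon> ^ d) * (\<Sum>l\<in>P. t l)"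
      using \<open>finite P\<close> deg by (simp add: f_def sum_distrib_left)
    have "P \<union> (L-P) = L" using \<open>P \<subseteq> L\<close> by blast
    moreover have "infsum f (P \<union> (L-P)) = infsum f P + infsum f (L-P)"
      using summable_on_finite[OF \<open>finite P\<close>] abs_summable_summable[OF abs]
      by (rule infsum_Un_disjoint) blast
    ultimately have split: "infsum f L / of_real (\<epsilon> ^ d) - (\<Sum>l\<in>P. t l) = infsum f (L-P) / of_real (\<epsilon> ^ d)"
      using that by (simp add: fP field_simps)
    have term_le: "norm (f l) \<le> \<epsilon> ^ Suc d * 2 ^ Suc d * ((1/2) ^ n l * norm (t l))" if l: "l \<in> L - P" for l
    proof (cases "n l \<le> d")
      case True
      then show ?thesis using vanish[OF l] e by (simp add: nf)
    next
      case False
      then obtain k where k: "n l = Suc d + k"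
        using nat_le_iff_add[of "Suc d" "n l"] by auto
      have "\<epsilon> ^ n l = \<epsilon> ^ Suc d * \<epsilon> ^ k" by (simp only: k power_add)
      also have "\<dots> \<le> \<epsilon> ^ Suc d * (1/2) ^ k"
        using \<open>0 < \<epsilon>\<close> \<open>\<epsilon> < 1/2\<close> by (intro mult_left_mono power_mono) auto
      also have "\<dots> = \<epsilon> ^ Suc d * 2 ^ Suc d * (1/2) ^ n l"
        by (simp add: k power_add field_simps)
      finally show ?thesis
        unfolding nf mult.assoc[symmetric] by (rule mult_right_mono) simp
    qed
    have "norm (infsum f (L-P)) \<le> (\<Sum>\<^sub>\<infinity>l\<in>L-P. norm (f l))"
      using abs by (rule norm_infsum_bound)
    also have "\<dots> \<le> (\<Sum>\<^sub>\<infinity>l\<in>L-P. \<epsilon> ^ Suc d * 2 ^ Suc d * ((1/2) ^ n l * norm (t l)))"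
      by (intro infsum_mono abs summable_on_cmult_right summP term_le) auto
    also have "\<dots> = \<epsilon> ^ Suc d * K"
      by (simp only: K_def infsum_cmult_right' mult.assoc)
    finally have "norm (infsum f (L-P)) \<le> \<epsilon> ^ Suc d * K" .
    then have "norm (infsum f (L-P) / of_real (\<epsilon> ^ d)) \<le> \<epsilon> * K"
      using e by (simp add: norm_divide norm_power field_simps)
    then show ?thesis by (simp only: split[symmetric] f_def[symmetric])
  qed
  have ev: "eventually (\<lambda>\<epsilon>::real. 0 < \<epsilon> \<and> \<epsilon> < 1/2) (at_right 0)"
    by (simp add: eventually_at_right_field) (rule exI[of _ "1/2"], simp)
  show ?thesis
  proof (rule Lim_null[THEN iffD2], rule Lim_null_comparison)
    show "eventually (\<lambda>\<epsilon>. norm ((\<Sum>\<^sub>\<infinity>l\<in>L. of_real (\<epsilon> ^ n l) * t l) / of_real (\<epsilon> ^ d) - (\<Sum>l\<in>P. t l)) \<le> \<epsilon> * K) (at_right 0)"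
      using ev by eventually_elim (rule bound, auto)
    show "((\<lambda>\<epsilon>. \<epsilon> * K) \<longlongrightarrow> 0) (at_right (0::real))"
      by (rule tendsto_eq_intros tendsto_ident_at refl)+ simp
  qed
qed

section \<open>Loops as rotation orbits\<close>

lemma length_loop_edges [simp]: "length (loop_edges xs) = length xs"
  by (simp add: loop_edges_def)

lemma loop_edges_rotate: "loop_edges (rotate k xs) = rotate k (loop_edges xs)"
proof -
  have "zip (rotate1 xs) (rotate1 ys) = rotate1 (zip xs ys)" if "length xs = length ys" for xs ys :: "'a list"
    using that by (cases xs; cases ys) auto
  then have "loop_edges (rotate1 xs) = rotate1 (loop_edges xs)" for xs :: "'a list"
    by (simp add: loop_edges_def)
  then show ?thesis
    by (induction k) auto
qed

lemma set_loop_edges: "(x, y) \<in> set (loop_edges xs) \<Longrightarrow> x \<in> set xs \<and> y \<in> set xs"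
  by (auto simp: loop_edges_def dest: set_zip_leftD set_zip_rightD)

definition orbit :: "'v list \<Rightarrow> 'v list set" where
  "orbit xs = range (\<lambda>k. rotate k xs)"

text \<open>A quotient consists of the images of single points under the relation, and
  \<open>shift_rel\<close> sends a based loop exactly to its rotations.\<close>

lemma loops_eq_orbits: "loops X E = orbit ` based_loops X E"
  by (auto simp: loops_def quotient_def shift_rel_def orbit_def)

lemma self_in_orbit: "xs \<in> orbit xs"
  unfolding orbit_def by (rule range_eqI[of _ _ 0]) simp

text \<open>Rotation invariance makes the image of the orbit a singleton. Length, mass and holonomy
  class of a loop are all evaluated on a representative in this way.\<close>

lemma the_elem_orbit:
  assumes "\<And>k. f (rotate k xs) = f xs"
  shows "the_elem (f ` orbit xs) = f xs"
proof -
  have "f ` orbit xs = {f xs}"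
    using assms self_in_orbit[of xs] by (auto simp: orbit_def)
  then show ?thesis by simp
qed

lemma loop_length_orbit [simp]: "loop_length (orbit xs) = length xs"
  unfolding loop_length_def by (rule the_elem_orbit) simp

definition loop_prod :: "('v \<Rightarrow> 'v \<Rightarrow> real) \<Rightarrow> 'v list \<Rightarrow> real" where
  "loop_prod P xs = (\<Prod>(x, y)\<leftarrow>loop_edges xs. P x y)"

lemma prod_list_rotate: "prod_list (rotate k xs) = (prod_list xs :: 'a :: comm_monoid_mult)"
proof -
  have "prod_list (rotate k xs) = prod_list (take (k mod length xs) xs @ drop (k mod length xs) xs)"
    unfolding rotate_drop_take prod_list.append by (rule mult.commute)
  then show ?thesis by simp
qed

lemma loop_prod_rotate: "loop_prod P (rotate k xs) = loop_prod P xs"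
  by (simp add: loop_prod_def loop_edges_rotate rotate_map[symmetric] prod_list_rotate)

text \<open>Only the product is evaluated on the representative. The multiplicity stays unevaluated:
  it depends on the loop alone, hence is the same for every killing measure.\<close>

lemma loop_measure_orbit:
  "loop_measure X C \<kappa> (orbit xs) =
     loop_prod (transition X C \<kappa>) xs / real (loop_multiplicity (orbit xs))"
proof -
  have "the_elem (loop_prod (transition X C \<kappa>) ` orbit xs) = loop_prod (transition X C \<kappa>) xs"
    by (rule the_elem_orbit) (rule loop_prod_rotate)
  then show ?thesis
    by (simp add: loop_measure_def loop_prod_def[abs_def])
qed

lemma finite_loops_of_length:
  assumes "finite X"
  shows "finite {l \<in> loops X E. loop_length l = n}"
proof (rule finite_subset)
  show "{l \<in> loops X E. loop_length l = n} \<subseteq> orbit ` {xs. set xs \<subseteq> X \<and> length xs = n}"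
    by (auto simp: loops_eq_orbits based_loops_def)
qed (use assms finite_lists_length_eq in auto)

section \<open>Sums over closed paths\<close>

text \<open>Weight of the open walk from \<open>x\<close> through the listed vertices. Unlike the
  closed product, it splits off its first step, which allows induction on the length.\<close>

fun path_weight :: "('v \<Rightarrow> 'v \<Rightarrow> real) \<Rightarrow> 'v \<Rightarrow> 'v list \<Rightarrow> real" where
  "path_weight P x [] = 1"
| "path_weight P x (y # ys) = P x y * path_weight P y ys"

lemma path_weight_eq_prod: "path_weight P x (ys @ [z]) = (\<Prod>(a, b)\<leftarrow>zip (x # ys) (ys @ [z]). P a b)"
  by (induction ys arbitrary: x) auto

lemma loop_prod_Cons: "loop_prod P (x # xs) = path_weight P x (xs @ [x])"
  by (simp add: loop_prod_def loop_edges_def path_weight_eq_prod)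

lemma lists_Suc_length:
  "{xs. set xs \<subseteq> X \<and> length xs = Suc n} = (\<lambda>(x, xs). x # xs) ` (X \<times> {xs. set xs \<subseteq> X \<and> length xs = n})"
  by (auto simp: length_Suc_conv image_iff)

lemma sum_lists_Suc:
  "(\<Sum>xs | set xs \<subseteq> X \<and> length xs = Suc n. f xs) =
   (\<Sum>x\<in>X. \<Sum>xs | set xs \<subseteq> X \<and> length xs = n. f (x # xs))"
  unfolding lists_Suc_length sum.cartesian_product
  by (subst sum.reindex) (auto simp: inj_on_def case_prod_beta)

text \<open>Isolates what the convergence proof takes from the transition matrix: with killing, a
  row may sum to less than 1.\<close>

locale substochastic =
  fixes X :: "'v set" and P :: "'v \<Rightarrow> 'v \<Rightarrow> real"
  assumes finite: "finite X"
    and nonneg: "\<And>x y. x \<in> X \<Longrightarrow> y \<in> X \<Longrightarrow> 0 \<le> P x y"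
    and row_sum_le: "\<And>x. x \<in> X \<Longrightarrow> (\<Sum>y\<in>X. P x y) \<le> 1"
begin

lemma path_weight_nonneg: "x \<in> X \<Longrightarrow> set ys \<subseteq> X \<Longrightarrow> 0 \<le> path_weight P x ys"
  by (induction ys arbitrary: x) (auto intro: nonneg mult_nonneg_nonneg)

text \<open>This is the total probability that the killed walk survives \<open>n\<close> steps;
  conditioning on the first step gives the induction.\<close>

lemma sum_path_weight_le:
  "x \<in> X \<Longrightarrow> (\<Sum>ys | set ys \<subseteq> X \<and> length ys = n. path_weight P x ys) \<le> 1"
proof (induction n arbitrary: x)
  case 0
  have "{ys. set ys \<subseteq> X \<and> length ys = 0} = {[]}" by auto
  then show ?case by (simp only: sum.insert finite.emptyI) simp
next
  case (Suc n)
  have "(\<Sum>ys | set ys \<subseteq> X \<and> length ys = Suc n. path_weight P x ys) =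
     (\<Sum>y\<in>X. P x y * (\<Sum>ys | set ys \<subseteq> X \<and> length ys = n. path_weight P y ys))"
    by (simp add: sum_lists_Suc sum_distrib_left)
  also have "\<dots> \<le> (\<Sum>y\<in>X. P x y * 1)"
    using Suc by (intro sum_mono mult_left_mono nonneg) auto
  finally show ?case using row_sum_le[OF Suc.prems] by simp
qed

lemma loop_prod_nonneg: "set xs \<subseteq> X \<Longrightarrow> 0 \<le> loop_prod P xs"
  unfolding loop_prod_def using nonneg
  by (intro prod_list_nonneg) (auto dest!: set_loop_edges)

text \<open>Closed walks from a fixed \<open>x\<close> are among all walks from \<open>x\<close>, so
  each starting point contributes at most 1. The extra 1 covers \<open>n = 0\<close>, where the
  empty list has product 1 even if \<open>X\<close> is empty.\<close>

lemma sum_loop_prod_le: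
  "(\<Sum>xs | set xs \<subseteq> X \<and> length xs = n. loop_prod P xs) \<le> real (card X) + 1"
proof (cases n)
  case 0
  have "{ys. set ys \<subseteq> X \<and> length ys = 0} = {[]}" by auto
  then show ?thesis using 0 by (simp add: loop_prod_def loop_edges_def)
next
  case (Suc m)
  have "(\<Sum>xs | set xs \<subseteq> X \<and> length xs = m. path_weight P x (xs @ [x])) \<le> 1" if "x \<in> X" for x
  proof -
    let ?A = "\<lambda>n. {xs. set xs \<subseteq> X \<and> length xs = n}"
    \<comment> \<open>Appending the return to \<open>x\<close> embeds the closed walks injectively
      into the open walks with one more vertex listed.\<close>
    have "(\<Sum>xs\<in>?A m. path_weight P x (xs @ [x])) = (\<Sum>ys\<in>(\<lambda>xs. xs @ [x]) ` ?A m. path_weight P x ys)"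
      by (subst sum.reindex) (auto simp: inj_on_def)
    also have "\<dots> \<le> (\<Sum>ys\<in>?A (Suc m). path_weight P x ys)"
      using that by (intro sum_mono2 finite_lists_length_eq finite path_weight_nonneg) auto
    finally show ?thesis using sum_path_weight_le[OF that, of "Suc m"] by simp
  qed
  then have "(\<Sum>x\<in>X. \<Sum>xs | set xs \<subseteq> X \<and> length xs = m. loop_prod P (x # xs)) \<le> (\<Sum>x\<in>X. 1)"
    unfolding loop_prod_Cons by (intro sum_mono) auto
  then show ?thesis by (simp add: Suc sum_lists_Suc)
qed

text \<open>The terms are nonnegative, so it suffices to bound finite partial sums. Sorted by
  length, these are dominated by a geometric series in \<epsilon>.\<close>

lemma summable_on_loop_prod:
  assumes "0 < \<epsilon>" "\<epsilon> < 1"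
  shows "(\<lambda>xs. \<epsilon> ^ length xs * loop_prod P xs) summable_on {xs. set xs \<subseteq> X}"
proof (rule nonneg_bdd_above_summable_on)
  show "0 \<le> \<epsilon> ^ length xs * loop_prod P xs" if "xs \<in> {xs. set xs \<subseteq> X}" for xs
    using that assms loop_prod_nonneg by simp
  let ?f = "\<lambda>xs. \<epsilon> ^ length xs * loop_prod P xs"
  let ?A = "\<lambda>n. {xs. set xs \<subseteq> X \<and> length xs = n}"
  have "sum ?f F \<le> (real (card X) + 1) * (1 / (1 - \<epsilon>))" if F: "F \<subseteq> {xs. set xs \<subseteq> X}" "finite F" for F
  proof -
    \<comment> \<open>A strict bound on all lengths in \<open>F\<close>. For empty \<open>F\<close>
      the maximum is unspecified, but the inclusion below is then trivial.\<close>
    define N where "N = Suc (Max (length ` F))"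
    have "F \<subseteq> (\<Union>n<N. ?A n)"
      using F by (auto simp: N_def less_Suc_eq_le)
    then have "sum ?f F \<le> sum ?f (\<Union>n<N. ?A n)"
      using assms by (intro sum_mono2) (auto intro!: finite_lists_length_eq finite loop_prod_nonneg mult_nonneg_nonneg)
    also have "\<dots> = (\<Sum>n<N. sum ?f (?A n))"
      by (rule sum.UNION_disjoint) (auto intro!: finite_lists_length_eq finite)
    also have "\<dots> = (\<Sum>n<N. \<epsilon> ^ n * sum (loop_prod P) (?A n))"
      by (simp add: sum_distrib_left)
    also have "\<dots> \<le> (\<Sum>n<N. \<epsilon> ^ n * (real (card X) + 1))"
      using assms by (intro sum_mono mult_left_mono sum_loop_prod_le) auto
    also have "\<dots> = (real (card X) + 1) * (\<Sum>n<N. \<epsilon> ^ n)"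
      by (simp add: sum_distrib_left mult.commute)
    also have "\<dots> \<le> (real (card X) + 1) * (\<Sum>n. \<epsilon> ^ n)"
      using assms by (intro mult_left_mono sum_le_suminf summable_geometric) auto
    finally show ?thesis
      using assms by (simp add: suminf_geometric)
  qed
  then show "bdd_above (sum ?f ` {F. F \<subseteq> {xs. set xs \<subseteq> X} \<and> finite F})"
    by (intro bdd_aboveI2) auto
qed

text \<open>One chosen representative per loop embeds the loops injectively into the lists over
  \<open>X\<close>, and division by the multiplicity does not increase the mass.\<close>

lemma summable_on_loop_measure:
  assumes "0 < \<epsilon>" "\<epsilon> < 1" and P: "P = transition X C \<kappa>"
  shows "(\<lambda>l. \<epsilon> ^ loop_length l * loop_measure X C \<kappa> l) summable_on loops X E"
proof -
  define r where "r = inv_into (based_loops X E) orbit"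
  have r: "r l \<in> based_loops X E" "orbit (r l) = l" if "l \<in> loops X E" for l
    using that unfolding r_def loops_eq_orbits by (rule inv_into_into, rule f_inv_into_f)
  then have inj: "inj_on r (loops X E)" by (metis inj_onI)
  have rX: "set (r l) \<subseteq> X" if "l \<in> loops X E" for l
    using r(1)[OF that] by (auto simp: based_loops_def)
  let ?f = "\<lambda>xs. \<epsilon> ^ length xs * loop_prod P xs"
  have "?f summable_on r ` loops X E"
    using rX by (intro summable_on_subset_banach[OF summable_on_loop_prod[OF assms(1,2)]]) auto
  then have "(?f \<circ> r) summable_on loops X E"
    using inj by (simp add: summable_on_reindex)
  then show ?thesis
  proof (rule summable_on_comparison_test)
    fix l assume l: "l \<in> loops X E"
    have eq: "\<epsilon> ^ loop_length l * loop_measure X C \<kappa> l = ?f (r l) / real (loop_multiplicity l)"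
      using loop_measure_orbit[of X C \<kappa> "r l"] loop_length_orbit[of "r l"] by (simp add: r(2)[OF l] P)
    have f0: "0 \<le> ?f (r l)" using loop_prod_nonneg[OF rX[OF l]] assms by simp
    show "0 \<le> \<epsilon> ^ loop_length l * loop_measure X C \<kappa> l" unfolding eq using f0 by simp
    show "\<epsilon> ^ loop_length l * loop_measure X C \<kappa> l \<le> (?f \<circ> r) l"
    proof (cases "loop_multiplicity l = 0")
      \<comment> \<open>With \<open>1 / 0 = 0\<close> the bound needs no information about the multiplicity.\<close>
      case True
      with f0 show ?thesis unfolding eq by simp
    next
      case False
      then have "?f (r l) * 1 \<le> ?f (r l) * real (loop_multiplicity l)"
        using f0 by (intro mult_left_mono) auto
      with False eq show ?thesis by (simp add: divide_le_eq)
    qed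
  qed
qed

end

section \<open>Transition probabilities under scaling\<close>

text \<open>In the double sum each edge at \<open>x\<close> occurs once from either end, which the
  factor 1/2 compensates. Tested on indicators, positive definiteness thus yields positive total
  weights.\<close>

lemma energy_indicator:
  assumes "finite X" "x \<in> X" "C x x = 0" "\<And>y. y \<in> X \<Longrightarrow> C x y = C y x"
  shows "energy X C \<kappa> (\<lambda>y. if y = x then 1 else 0) = total_weight X C \<kappa> x"
proof -
  let ?f = "\<lambda>y. if y = x then 1 else 0 :: real"
  have inner: "(\<Sum>z\<in>X. C y z * (?f y - ?f z)\<^sup>2) = (if y = x then (\<Sum>z\<in>X. C x z) else C y x)" if "y \<in> X" for y
  proof (cases "y = x")
    case True
    have "C x z * (?f x - ?f z)\<^sup>2 = C x z" for z using assms(3) by (cases "z = x") auto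
    with True show ?thesis by (simp only: simp_thms if_True)
  next
    case False
    then have "(\<Sum>z\<in>X. C y z * (?f y - ?f z)\<^sup>2) = (\<Sum>z\<in>X. if z = x then C y z else 0)"
      by (intro sum.cong) auto
    with False assms(1,2) show ?thesis by simp
  qed
  have "(\<Sum>y\<in>X. \<Sum>z\<in>X. C y z * (?f y - ?f z)\<^sup>2) = (\<Sum>y\<in>X. (if y = x then (\<Sum>z\<in>X. C x z) else 0) + C x y)"
  proof (rule sum.cong)
    show "(\<Sum>z\<in>X. C y z * (?f y - ?f z)\<^sup>2) = (if y = x then (\<Sum>z\<in>X. C x z) else 0) + C x y" if "y \<in> X" for y
      using inner[OF that] assms(3) assms(4)[OF that] by (cases "y = x") simp_all
  qed simp
  also have "\<dots> = 2 * (\<Sum>z\<in>X. C x z)"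
    using assms(1,2) by (simp add: sum.distrib)
  finally have "(\<Sum>y\<in>X. \<Sum>z\<in>X. C y z * (?f y - ?f z)\<^sup>2) = 2 * (\<Sum>z\<in>X. C x z)" .
  moreover have "(\<Sum>y\<in>X. \<kappa> y * (?f y)\<^sup>2) = (\<Sum>y\<in>X. if y = x then \<kappa> y else 0)"
    by (intro sum.cong) auto
  ultimately show ?thesis
    using assms(1,2) by (simp add: energy_def total_weight_def)
qed

lemma total_weight_pos:
  assumes "simple_graph X E" "conductances X E C" "energy_pos_def X C \<kappa>" "x \<in> X"
  shows "0 < total_weight X C \<kappa> x"
proof -
  have "{x, x} \<notin> E" using assms(1) by (auto simp: simple_graph_def)
  then have "energy X C \<kappa> (\<lambda>y. if y = x then 1 else 0) = total_weight X C \<kappa> x"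
    using assms by (intro energy_indicator) (auto simp: simple_graph_def conductances_def)
  moreover have "energy X C \<kappa> (\<lambda>y. if y = x then 1 else 0) > 0"
    using assms(3,4) unfolding energy_pos_def_def by (elim allE impE) auto
  ultimately show ?thesis by simp
qed

lemma substochastic_transition:
  assumes "simple_graph X E" "conductances X E C" "\<forall>x\<in>X. \<kappa> x \<ge> 0" "energy_pos_def X C \<kappa>"
  shows "substochastic X (transition X C \<kappa>)"
proof
  show "finite X" using assms(1) by (simp add: simple_graph_def)
next
  fix x y assume xy: "x \<in> X" "y \<in> X"
  with assms(2) have "0 \<le> C x y" by (auto simp: conductances_def)
  with total_weight_pos[OF assms(1,2,4) xy(1)] show "0 \<le> transition X C \<kappa> x y"
    by (simp add: transition_def)
next
  fix x assume x: "x \<in> X"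
  have "(\<Sum>y\<in>X. transition X C \<kappa> x y) = (\<Sum>y\<in>X. C x y) / total_weight X C \<kappa> x"
    by (simp add: transition_def sum_divide_distrib)
  with total_weight_pos[OF assms(1,2,4) x] assms(3) x show "(\<Sum>y\<in>X. transition X C \<kappa> x y) \<le> 1"
    by (simp add: total_weight_def)
qed

text \<open>The conductances are unchanged, while \<lambda> becomes \<lambda> + \<lambda>(1 -
  \<epsilon>)/\<epsilon> = \<lambda>/\<epsilon>.\<close>

lemma transition_scaled_killing:
  assumes "\<epsilon> \<noteq> 0"
  shows "transition X C (scaled_killing X C \<kappa> \<epsilon>) x y = \<epsilon> * transition X C \<kappa> x y"
proof -
  have "total_weight X C (scaled_killing X C \<kappa> \<epsilon>) x = total_weight X C \<kappa> x + total_weight X C \<kappa> x * (1 - \<epsilon>) / \<epsilon>"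
    by (simp add: total_weight_def scaled_killing_def)
  also have "\<dots> = total_weight X C \<kappa> x / \<epsilon>"
    using assms by (simp add: field_simps)
  finally show ?thesis by (simp add: transition_def)
qed

lemma loop_prod_scale: "loop_prod (\<lambda>x y. \<epsilon> * P x y) xs = \<epsilon> ^ length xs * loop_prod P xs"
proof -
  have "(\<Prod>(x, y)\<leftarrow>es. \<epsilon> * P x y) = \<epsilon> ^ length es * (\<Prod>(x, y)\<leftarrow>es. P x y)" for es
    by (induction es) (auto simp: algebra_simps)
  then show ?thesis by (simp add: loop_prod_def)
qed

lemma loop_measure_scaled_killing:
  assumes "\<epsilon> \<noteq> 0" "l \<in> loops X E"
  shows "loop_measure X C (scaled_killing X C \<kappa> \<epsilon>) l = \<epsilon> ^ loop_length l * loop_measure X C \<kappa> l"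
proof -
  have "transition X C (scaled_killing X C \<kappa> \<epsilon>) = (\<lambda>x y. \<epsilon> * transition X C \<kappa> x y)"
    using assms(1) by (intro ext transition_scaled_killing)
  with assms(2) show ?thesis
    by (auto simp: loops_eq_orbits loop_measure_orbit loop_prod_scale)
qed

section \<open>Holonomies\<close>

context group
begin

text \<open>Since \<open>a \<otimes> b\<close> is the conjugate of \<open>b \<otimes> a\<close> by
  \<open>a\<close>, the conjugator \<open>h\<close> turns into \<open>h \<otimes> a\<close>. This
  handles a change of base point of a loop.\<close>

lemma conjugacy_class_mult_subset:
  assumes "a \<in> carrier G" "b \<in> carrier G"
  shows "conjugacy_class G (a \<otimes> b) \<subseteq> conjugacy_class G (b \<otimes> a)"
proof
  fix g assume "g \<in> conjugacy_class G (a \<otimes> b)"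
  then obtain h where h: "h \<in> carrier G" "g = h \<otimes> (a \<otimes> b) \<otimes> inv h"
    by (auto simp: conjugacy_class_def)
  have "g = (h \<otimes> a) \<otimes> (b \<otimes> a) \<otimes> inv (h \<otimes> a)"
    using h assms by (simp add: inv_mult_group m_assoc) (simp add: m_assoc[symmetric])
  then show "g \<in> conjugacy_class G (b \<otimes> a)"
    using h assms unfolding conjugacy_class_def by blast
qed

lemma conjugacy_class_mult_commute:
  assumes "a \<in> carrier G" "b \<in> carrier G"
  shows "conjugacy_class G (a \<otimes> b) = conjugacy_class G (b \<otimes> a)"
  using assms conjugacy_class_mult_subset by blast

text \<open>Cyclicity of the trace cancels the conjugator, so the character is constant on the
  class.\<close>

lemma class_character_conjugacy_class:
  assumes "unitary_representation G \<pi>" "g \<in> carrier G"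
  shows "class_character \<pi> (conjugacy_class G g) = normalized_character \<pi> g"
proof -
  have mult: "\<pi> (a \<otimes> b) = \<pi> a ** \<pi> b" if "a \<in> carrier G" "b \<in> carrier G" for a b
    using assms(1) that by (auto simp: unitary_representation_def hom_def unitary_group_def)
  have "trace (\<pi> (h \<otimes> g \<otimes> inv h)) = trace (\<pi> g)" if h: "h \<in> carrier G" for h
  proof -
    have "trace (\<pi> (h \<otimes> g \<otimes> inv h)) = trace (\<pi> (h \<otimes> g) ** \<pi> (inv h))"
      using assms(2) h by (simp add: mult)
    also have "\<dots> = trace (\<pi> (inv h \<otimes> (h \<otimes> g)))"
      using assms(2) h mult[of "inv h" "h \<otimes> g"] trace_mul_sym[of "\<pi> (h \<otimes> g)"] by simp
    also have "\<dots> = trace (\<pi> g)"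
      using assms(2) h by (simp add: m_assoc[symmetric])
    finally show ?thesis .
  qed
  then have const: "normalized_character \<pi> x = normalized_character \<pi> g" if "x \<in> conjugacy_class G g" for x
    using that by (auto simp: conjugacy_class_def normalized_character_def)
  have "conjugacy_class G g \<noteq> {}"
    unfolding conjugacy_class_def using one_closed by blast
  then have "normalized_character \<pi> ` conjugacy_class G g = {normalized_character \<pi> g}"
    by (simp add: const image_constant_conv cong: image_cong_simp)
  then show ?thesis by (simp add: class_character_def)
qed

text \<open>Membership in \<open>hom\<close> only gives multiplicativity, so
  \<open>\<pi> \<one>\<close> is at first just idempotent; being unitary it is invertible, hence the
  identity matrix.\<close>

lemma normalized_character_one:
  assumes "unitary_representation G \<pi>"
  shows "normalized_character \<pi> \<one> = 1"
proof -
  have hom: "\<pi> \<one> = \<pi> \<one> ** \<pi> \<one>" "\<pi> \<one> ** adjoint_matrix (\<pi> \<one>) = mat 1"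
    using assms by (auto simp: unitary_representation_def hom_def unitary_group_def Pi_iff)
      (metis l_one one_closed)
  have "\<pi> \<one> = \<pi> \<one> ** (\<pi> \<one> ** adjoint_matrix (\<pi> \<one>))"
    by (simp add: hom(2))
  also have "\<dots> = mat 1"
    unfolding matrix_mul_assoc by (simp only: hom(1)[symmetric] hom(2))
  finally show ?thesis
    by (simp add: normalized_character_def trace_def mat_def)
qed

end

locale assigned_graph = group M for M :: "('m, 'b) monoid_scheme" (structure) +
  fixes E :: "'v set set" and U :: "'v \<times> 'v \<Rightarrow> 'm"
  assumes assign: "assignment E M U"
begin

definition edges :: "('v \<times> 'v) set" where "edges = {(x, y). {x, y} \<in> E}"

text \<open>Taken on lists of oriented edges rather than vertices, because tail removal acts on such
  lists.\<close>

definition holonomy :: "('v \<times> 'v) list \<Rightarrow> 'm" where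
  "holonomy es = foldr (\<otimes>) (map U es) \<one>"

lemma holonomy_simps [simp]:
  "holonomy [] = \<one>" "holonomy (e # es) = U e \<otimes> holonomy es"
  by (simp_all add: holonomy_def)

lemma U_closed: "e \<in> edges \<Longrightarrow> U e \<in> carrier M"
  using assign by (cases e) (auto simp: edges_def assignment_def)

lemma holonomy_closed: "set es \<subseteq> edges \<Longrightarrow> holonomy es \<in> carrier M"
  by (induction es) (auto intro: U_closed)

lemma holonomy_append:
  "set es \<subseteq> edges \<Longrightarrow> set fs \<subseteq> edges \<Longrightarrow> holonomy (es @ fs) = holonomy es \<otimes> holonomy fs"
  by (induction es) (auto simp: m_assoc U_closed holonomy_closed)

text \<open>A rotation exchanges the two blocks of a cut. The explicit factors give both equality of
  conjugacy classes and transfer of triviality.\<close>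

lemma holonomy_rotate:
  assumes "set es \<subseteq> edges"
  obtains a b where "a \<in> carrier M" "b \<in> carrier M" "holonomy es = a \<otimes> b" "holonomy (rotate k es) = b \<otimes> a"
proof
  let ?k = "k mod length es"
  have s: "set (take ?k es) \<subseteq> edges" "set (drop ?k es) \<subseteq> edges"
    using assms set_take_subset set_drop_subset by (blast dest: in_set_takeD in_set_dropD)+
  show "holonomy (take ?k es) \<in> carrier M" "holonomy (drop ?k es) \<in> carrier M"
    using s by (simp_all add: holonomy_closed)
  show "holonomy es = holonomy (take ?k es) \<otimes> holonomy (drop ?k es)"
    using holonomy_append[OF s] by simp
  show "holonomy (rotate k es) = holonomy (drop ?k es) \<otimes> holonomy (take ?k es)"
    unfolding rotate_drop_take using holonomy_append[OF s(2,1)] .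
qed

text \<open>The two inverse edges cancel once rotated to the front. Because that rotation may
  conjugate the holonomy, what is passed back from \<open>fs\<close> to \<open>es\<close> is
  triviality, not the value.\<close>

lemma holonomy_tail_removal:
  assumes "tail_removal es fs" "set es \<subseteq> edges"
  shows "set fs \<subseteq> edges" and "holonomy fs = \<one> \<Longrightarrow> holonomy es = \<one>"
proof -
  obtain k x y where k: "rotate k es = (x, y) # (y, x) # fs"
    using assms(1) by (auto simp: tail_removal_def)
  then have sub: "set ((x, y) # (y, x) # fs) \<subseteq> edges"
    using assms(2) by (metis set_rotate)
  then show "set fs \<subseteq> edges" by simp
  assume one: "holonomy fs = \<one>"
  have "{x, y} \<in> E" using sub by (simp add: edges_def)
  then have "U (y, x) = inv U (x, y)" "U (x, y) \<in> carrier M"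
    using assign unfolding assignment_def by blast+
  then have rot: "holonomy (rotate k es) = \<one>"
    by (simp add: k one)
  obtain a b where ab: "a \<in> carrier M" "b \<in> carrier M" "holonomy es = a \<otimes> b" "holonomy (rotate k es) = b \<otimes> a"
    using holonomy_rotate[OF assms(2)] .
  \<comment> \<open>In a group \<open>b \<otimes> a = \<one>\<close> forces
    \<open>a \<otimes> b = \<one>\<close>, which undoes the rotation.\<close>
  with rot show "holonomy es = \<one>"
    using inv_comm[OF _ ab(2,1)] by simp
qed

text \<open>Induction backwards from the empty edge list, whose holonomy is
  \<open>\<one>\<close>.\<close>

lemma holonomy_contractible:
  "tail_removal\<^sup>*\<^sup>* es [] \<Longrightarrow> set es \<subseteq> edges \<Longrightarrow> holonomy es = \<one>"
  by (induction rule: converse_rtranclp_induct) (auto dest: holonomy_tail_removal)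

lemma loop_edges_subset: "xs \<in> based_loops X E \<Longrightarrow> set (loop_edges xs) \<subseteq> edges"
  by (auto simp: based_loops_def edges_def)

lemma holonomy_class_orbit:
  assumes "xs \<in> based_loops X E"
  shows "holonomy_class M U (orbit xs) = conjugacy_class M (holonomy (loop_edges xs))"
proof -
  have "conjugacy_class M (holonomy (loop_edges (rotate k xs))) = conjugacy_class M (holonomy (loop_edges xs))" for k
    unfolding loop_edges_rotate
    by (rule holonomy_rotate[OF loop_edges_subset[OF assms], of k]) (simp add: conjugacy_class_mult_commute)
  then have "the_elem ((\<lambda>xs. conjugacy_class M (holonomy (loop_edges xs))) ` orbit xs) =
      conjugacy_class M (holonomy (loop_edges xs))"
    by (rule the_elem_orbit)
  then show ?thesis
    by (simp add: holonomy_class_def holonomy_def)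
qed

text \<open>A single group element serves both later uses: its range in \<open>M\<close> gives a
  uniform bound, and its triviality makes the loop term vanish.\<close>

lemma class_character_loop:
  assumes "unitary_representation M \<pi>" "l \<in> loops X E"
  obtains g where "g \<in> carrier M" "class_character \<pi> (holonomy_class M U l) = normalized_character \<pi> g"
    "homotopically_trivial l \<Longrightarrow> g = \<one>"
proof -
  obtain xs where xs: "xs \<in> based_loops X E" "l = orbit xs"
    using assms(2) by (auto simp: loops_eq_orbits)
  note sub = loop_edges_subset[OF xs(1)]
  show ?thesis
  proof
    show g: "holonomy (loop_edges xs) \<in> carrier M" using sub by (rule holonomy_closed)
    show "class_character \<pi> (holonomy_class M U l) = normalized_character \<pi> (holonomy (loop_edges xs))"
      using assms(1) g xs by (simp add: holonomy_class_orbit class_character_conjugacy_class)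
    assume "homotopically_trivial l"
    \<comment> \<open>The representative that contracts may be a rotation of \<open>xs\<close>; its
      trivial holonomy is carried back through the factors \<open>a\<close> and
      \<open>b\<close>.\<close>
    then obtain k where "tail_removal\<^sup>*\<^sup>* (rotate k (loop_edges xs)) []"
      by (auto simp: homotopically_trivial_def xs(2) orbit_def loop_edges_rotate)
    then have "holonomy (rotate k (loop_edges xs)) = \<one>"
      using sub by (intro holonomy_contractible) auto
    moreover obtain a b where ab: "a \<in> carrier M" "b \<in> carrier M"
        "holonomy (loop_edges xs) = a \<otimes> b" "holonomy (rotate k (loop_edges xs)) = b \<otimes> a"
      using holonomy_rotate[OF sub] .
    ultimately show "holonomy (loop_edges xs) = \<one>"
      using inv_comm[OF _ ab(2,1)] by simp
  qed
qed

lemma loop_term_homotopically_trivial: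
  assumes "unitary_representation M \<pi>" "l \<in> loops X E" "homotopically_trivial l"
  shows "loop_term X C \<kappa> M \<pi> U l = 0"
proof -
  obtain g where "class_character \<pi> (holonomy_class M U l) = normalized_character \<pi> g" "g = \<one>"
    using class_character_loop[OF assms(1,2)] assms(3) by blast
  then show ?thesis
    using assms(1) by (simp add: loop_term_def normalized_character_one)
qed

text \<open>A finite group has finitely many character values, so a maximum over \<open>M\<close>
  bounds all loops at once.\<close>

lemma norm_class_character_bounded:
  assumes "unitary_representation M \<pi>" "finite (carrier M)"
  obtains B where "\<And>l. l \<in> loops X E \<Longrightarrow> norm (class_character \<pi> (holonomy_class M U l) - 1) \<le> B"
proof
  fix l assume "l \<in> loops X E"
  then obtain g where "g \<in> carrier M" "class_character \<pi> (holonomy_class M U l) = normalized_character \<pi> g"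
    using class_character_loop[OF assms(1)] by blast
  then show "norm (class_character \<pi> (holonomy_class M U l) - 1)
      \<le> Max ((\<lambda>g. norm (normalized_character \<pi> g - 1)) ` carrier M)"
    using assms(2) by simp
qed

end

lemma loop_term_scaled_killing:
  assumes "\<epsilon> \<noteq> 0" "l \<in> loops X E"
  shows "loop_term X C (scaled_killing X C \<kappa> \<epsilon>) M \<pi> U l =
    of_real (\<epsilon> ^ loop_length l) * loop_term X C \<kappa> M \<pi> U l"
  using loop_measure_scaled_killing[OF assms, of C \<kappa>] by (simp add: loop_term_def)

text \<open>The first conjunct gives the weights their meaning: for a family that is not summable,
  \<open>infsum\<close> would be 0 by convention.\<close>

theorem proposition5p1:
  fixes X :: "'v set" and E :: "'v set set"
    and C :: "'v \<Rightarrow> 'v \<Rightarrow> real" and \<kappa> :: "'v \<Rightarrow> real"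
    and M :: "('m, 'b) monoid_scheme" and \<pi> :: "'m \<Rightarrow> complex^'n^'n"
    and c :: real and U :: "'v \<times> 'v \<Rightarrow> 'm"
  assumes "simple_graph X E" and "connected_graph X E" and "\<not> is_tree X E"
    and "conductances X E C" and "\<forall>x\<in>X. \<kappa> x \<ge> 0" and "energy_pos_def X C \<kappa>"
    and "group M" and "finite (carrier M)" and "unitary_representation M \<pi>"
    and "c > 0"
    and "assignment E M U"
  shows "(\<forall>\<epsilon>\<in>{0<..<1}.
            loop_term X C (scaled_killing X C \<kappa> \<epsilon>) M \<pi> U summable_on loops X E) \<and>
         ((\<lambda>\<epsilon>. loop_weight X E C (scaled_killing X C \<kappa> \<epsilon>) M \<pi>
                  (c / \<epsilon> ^ min_nontrivial_length X E) U)
            \<longlongrightarrow> plaquette_weight X E C \<kappa> M \<pi> c U) (at_right 0)"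
proof -
  interpret substochastic X "transition X C \<kappa>"
    using assms by (intro substochastic_transition)
  interpret assigned_graph M E U
    using assms by (intro assigned_graph.intro assigned_graph_axioms.intro)
  define d where "d = min_nontrivial_length X E"
  define t where "t = loop_term X C \<kappa> M \<pi> U"
  obtain B where B: "\<And>l. l \<in> loops X E \<Longrightarrow> norm (class_character \<pi> (holonomy_class M U l) - 1) \<le> B"
    using norm_class_character_bounded[OF assms(9,8)] by blast
  have \<mu>_nonneg: "0 \<le> loop_measure X C \<kappa> l" if "l \<in> loops X E" for l
    using that loop_prod_nonneg by (auto simp: loops_eq_orbits loop_measure_orbit based_loops_def)
  have summ: "(\<lambda>l. \<epsilon> ^ loop_length l * norm (t l)) summable_on loops X E" if e: "0 < \<epsilon>" "\<epsilon> < 1" for \<epsilon> :: real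
  \<comment> \<open>The character factor is at most \<open>B\<close> in norm, so the series is
    dominated by \<open>B\<close> times the summable loop masses.\<close>
  proof (rule summable_on_comparison_test)
    show "(\<lambda>l. \<epsilon> ^ loop_length l * loop_measure X C \<kappa> l * B) summable_on loops X E"
      by (intro summable_on_cmult_left summable_on_loop_measure e refl)
    show "\<epsilon> ^ loop_length l * norm (t l) \<le> \<epsilon> ^ loop_length l * loop_measure X C \<kappa> l * B"
      if "l \<in> loops X E" for l
      using B[OF that] \<mu>_nonneg[OF that] e
      by (simp add: t_def loop_term_def norm_mult mult.assoc mult_left_mono)
    show "0 \<le> \<epsilon> ^ loop_length l * norm (t l)" for l using e by simp
  qed
  have "loop_term X C (scaled_killing X C \<kappa> \<epsilon>) M \<pi> U summable_on loops X E" if e: "0 < \<epsilon>" "\<epsilon> < 1" for \<epsilon>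
  proof (rule abs_summable_summable)
    show "(\<lambda>l. norm (loop_term X C (scaled_killing X C \<kappa> \<epsilon>) M \<pi> U l)) summable_on loops X E"
      using summ[OF e] e
      by (rule_tac summable_on_cong[THEN iffD1, rotated])
        (auto simp: loop_term_scaled_killing norm_mult norm_power t_def)
  qed
  moreover have "((\<lambda>\<epsilon>. loop_weight X E C (scaled_killing X C \<kappa> \<epsilon>) M \<pi> (c / \<epsilon> ^ d) U)
            \<longlongrightarrow> plaquette_weight X E C \<kappa> M \<pi> c U) (at_right 0)"
  \<comment> \<open>The factor \<open>1 / \<epsilon> ^ d\<close> of \<alpha> is moved onto the loop
    sum, where the leading-order limit applies; both forms of the exponent agree for \<epsilon> >
    0.\<close>
  proof (rule Lim_transform_eventually)
    have "((\<lambda>\<epsilon>::real. (\<Sum>\<^sub>\<infinity>l\<in>loops X E. of_real (\<epsilon> ^ loop_length l) * t l) / of_real (\<epsilon> ^ d))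
        \<longlongrightarrow> (\<Sum>l\<in>plaquettes X E. t l)) (at_right 0)"
    proof (rule infsum_power_leading_order[OF summ])
      show "finite (plaquettes X E)"
        by (rule finite_subset[OF _ finite_loops_of_length[OF finite, of E d]]) (auto simp: plaquettes_def d_def)
      \<comment> \<open>By minimality of \<open>d\<close>, a homotopically non-trivial loop with at
        most \<open>d\<close> edges has exactly \<open>d\<close> and is a plaquette. Any other loop
        this short is therefore contractible.\<close>
      fix l assume l: "l \<in> loops X E - plaquettes X E" "loop_length l \<le> d"
      have "homotopically_trivial l"
      proof (rule ccontr)
        assume nt: "\<not> homotopically_trivial l"
        then have "d \<le> loop_length l"
          unfolding d_def min_nontrivial_length_def using l(1) by (intro Least_le) auto
        with l nt show False by (auto simp: plaquettes_def d_def)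
      qed
      with l(1) show "t l = 0"
        unfolding t_def by (intro loop_term_homotopically_trivial assms(9)) auto
    qed (auto simp: plaquettes_def d_def)
    then show "((\<lambda>\<epsilon>::real. exp (of_real c * ((\<Sum>\<^sub>\<infinity>l\<in>loops X E. of_real (\<epsilon> ^ loop_length l) * t l) / of_real (\<epsilon> ^ d))))
        \<longlongrightarrow> plaquette_weight X E C \<kappa> M \<pi> c U) (at_right 0)"
      unfolding plaquette_weight_def t_def by (intro tendsto_exp tendsto_mult_left)
    show "\<forall>\<^sub>F \<epsilon>::real in at_right 0.
        exp (of_real c * ((\<Sum>\<^sub>\<infinity>l\<in>loops X E. of_real (\<epsilon> ^ loop_length l) * t l) / of_real (\<epsilon> ^ d))) =
        loop_weight X E C (scaled_killing X C \<kappa> \<epsilon>) M \<pi> (c / \<epsilon> ^ d) U"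
      using eventually_at_right_less[of "0::real"]
    proof eventually_elim
      case (elim \<epsilon>)
      then have "(\<Sum>\<^sub>\<infinity>l\<in>loops X E. loop_term X C (scaled_killing X C \<kappa> \<epsilon>) M \<pi> U l) =
          (\<Sum>\<^sub>\<infinity>l\<in>loops X E. of_real (\<epsilon> ^ loop_length l) * t l)"
        unfolding t_def by (intro infsum_cong loop_term_scaled_killing) auto
      then show ?case by (simp add: loop_weight_def)
    qed
  qed
  ultimately show ?thesis by (auto simp: d_def)
qed

end
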